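(* Let $\vec m,\vec n$ be $n\times n$ difference-bound matrices over $\overline{\mathbb I}$ (with $\mathbb I\in\{\mathbb Z,\mathbb Q,\mathbb R\}$), and let $\vee$ be the entrywise maximum. Then: 1. $\mathcal D^0(\vec m\vee\vec n)\supseteq \mathcal D^0(\vec m)\cup\mathcal D^0(\vec n)$. 2. If $\vec m$ and $\vec n$ have non-empty $\mathcal V^0$-domains, then $$(\vec m^* )\vee(\vec n^* )=\inf_{\trianglelefteq}\{\vec o \text{ a DBM}\;|\;\mathcal D^0(\vec o)\supseteq\mathcal D^0(\vec m)\cup\mathcal D^0(\vec n)\}$$ (greatest lower bound for the order $\trianglelefteq$ on DBMs), and, as a consequence, $\mathcal D^0((\vec m^* )\vee(\vec n^* ))$ is the smallest $\mathcal V^0$-domain (with respect to $\subseteq$) which contains $\mathcal D^0(\vec m)\cup\mathcal D^0(\vec n)$. 3. If $\vec m$ and $\vec n$ are closed, then so is $\vec m\vee\vec n$.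
   Context: Let $\mathbb I$ be $\mathbb Z$, $\mathbb Q$ or $\mathbb R$, and $\overline{\mathbb I}=\mathbb I\cup\{+\infty\}$ with $\leq,+,\min,\max$ extended as usual. Let $\mathcal V=\{v_1,\dots,v_n\}$ be variables, where $v_1$ stands for the constant $0$ and $v_2,\dots,v_n$ are program variables. A difference-bound matrix (DBM) is an $n\times n$ matrix $\vec m$ with entries in $\overline{\mathbb I}$; the entry $\vec m_{ij}$ encodes the constraint $v_j-v_i\leq \vec m_{ij}$ (no constraint if $+\infty$). Define $\mathcal D(\vec m)=\{(x_1,\dots,x_n)\in\mathbb I^n\;|\;\forall i,j,\ x_j-x_i\leq\vec m_{ij}\}$ and the $\mathcal V^0$-domain $\mathcal D^0(\vec m)=\{(x_2,\dots,x_n)\in\mathbb I^{n-1}\;|\;(0,x_2,\dots,x_n)\in\mathcal D(\vec m)\}$. A subset of $\mathbb I^{n-1}$ is called a $\mathcal V^0$-domain if it equals $\mathcal D^0(\vec m)$ for some DBM $\vec m$. Order: $\vec m\trianglelefteq\vec n$ iff $\vec m_{ij}\leq\vec n_{ij}$ for all $i,j$. Closure: for a DBM $\vec m$ with non-empty $\mathcal V^0$-domain, $\vec m^*$ is the shortest-path closure: $\vec m^*_{ii}=0$, and for $i\neq j$, $\vec m^*_{ij}$ is the minimum of $\sum_{k=1}^{N-1}\vec m_{i_k i_{k+1}}$ over all finite sequences $i=i_1,i_2,\dots,i_N=j$ of indices. A DBM $\vec m$ is closed if it has non-empty $\mathcal V^0$-domain and $\vec m=\vec m^*$. $(\vec m\vee\vec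 n)_{ij}=\max(\vec m_{ij},\vec n_{ij})$. *)

theory Defs
  imports "HOL-Library.Extended_Real" "Jordan_Normal_Form.Matrix"
begin

text \<open>The scalar domain is a set \<open>I\<close> of reals, to be instantiated with the integers, the rationals
  or all reals; its extension by \<open>+\<infinity>\<close> is a subset of \<^typ>\<open>ereal\<close>. Matrix and vector
  indices start at 0, so index 0 belongs to the variable that stands for the constant 0. The order
  on DBMs is the library's entrywise \<open>\<le>\<close> on matrices.\<close>

definition DBM :: "real set \<Rightarrow> nat \<Rightarrow> ereal mat set" where
  "DBM I d = {m \<in> carrier_mat d d. \<forall>i<d. \<forall>j<d. m $$ (i, j) \<in> insert \<infinity> (ereal ` I)}"

definition dbm_dom :: "real set \<Rightarrow> ereal mat \<Rightarrow> real vec set" where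
  "dbm_dom I m = {x \<in> carrier_vec (dim_row m). (\<forall>i<dim_row m. x $ i \<in> I) \<and>
     (\<forall>i<dim_row m. \<forall>j<dim_row m. ereal (x $ j - x $ i) \<le> m $$ (i, j))}"

definition dbm_dom0 :: "real set \<Rightarrow> ereal mat \<Rightarrow> real vec set" where
  "dbm_dom0 I m = {x \<in> carrier_vec (dim_row m - 1). vCons 0 x \<in> dbm_dom I m}"

definition is_V0_domain :: "real set \<Rightarrow> nat \<Rightarrow> real vec set \<Rightarrow> bool" where
  "is_V0_domain I d X \<longleftrightarrow> (\<exists>m \<in> DBM I d. X = dbm_dom0 I m)"

definition path_weight :: "ereal mat \<Rightarrow> nat list \<Rightarrow> ereal" where
  "path_weight m p = (\<Sum>k<length p - 1. m $$ (p ! k, p ! Suc k))"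

text \<open>The minimum below exists for every DBM with a non-empty \<open>V\<^sup>0\<close>-domain; for other matrices the
  closure is not meaningful.\<close>

definition dbm_closure :: "ereal mat \<Rightarrow> ereal mat" where
  "dbm_closure m = mat (dim_row m) (dim_row m) (\<lambda>(i, j). if i = j then 0 else
     (LEAST w. \<exists>p. p \<noteq> [] \<and> set p \<subseteq> {..<dim_row m} \<and> hd p = i \<and> last p = j \<and> w = path_weight m p))"

definition dbm_closed :: "real set \<Rightarrow> ereal mat \<Rightarrow> bool" where
  "dbm_closed I m \<longleftrightarrow> dbm_dom0 I m \<noteq> {} \<and> m = dbm_closure m"

definition dbm_max :: "ereal mat \<Rightarrow> ereal mat \<Rightarrow> ereal mat" where
  "dbm_max m n = mat (dim_row m) (dim_col m) (\<lambda>(i, j). max (m $$ (i, j)) (n $$ (i, j)))"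

definition is_glb_in :: "'a::order set \<Rightarrow> 'a set \<Rightarrow> 'a \<Rightarrow> bool" where
  "is_glb_in P S g \<longleftrightarrow> g \<in> P \<and> (\<forall>s\<in>S. g \<le> s) \<and> (\<forall>l\<in>P. (\<forall>s\<in>S. l \<le> s) \<longrightarrow> l \<le> g)"

definition is_least_in :: "'a::order set \<Rightarrow> 'a \<Rightarrow> bool" where
  "is_least_in S x \<longleftrightarrow> x \<in> S \<and> (\<forall>y\<in>S. x \<le> y)"

end

theory Submission
  imports Defs
begin

text \<open>A closed DBM \<open>c\<close> with non-empty domain is tight: if \<open>y\<close> lies in its domain, then so does
  \<open>x\<^sub>j = min (c\<^sub>a\<^sub>j) (y\<^sub>j + K)\<close>, because \<open>c\<close> satisfies the triangle inequality. For large \<open>K\<close> we get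
  \<open>x\<^sub>a = 0\<close>, while \<open>x\<^sub>b\<close> equals \<open>c\<^sub>a\<^sub>b\<close> if that is finite and exceeds any bound otherwise. Hence the
  closure of a DBM is below every DBM whose domain contains the domain of the given one. The triangle
  inequality also passes to entrywise maxima, which makes the join of closed DBMs closed.\<close>

section \<open>Walks on the indices and their weights\<close>

text \<open>Isolates the condition under \<open>LEAST\<close> in \<open>dbm_closure\<close>, so that
  walks can be concatenated and shortened. One-element walks are allowed; their weight is the empty
  sum.\<close>

definition is_walk :: "nat \<Rightarrow> nat \<Rightarrow> nat \<Rightarrow> nat list \<Rightarrow> bool" where
  "is_walk d i j p \<longleftrightarrow> p \<noteq> [] \<and> set p \<subseteq> {..<d} \<and> hd p = i \<and> last p = j"

lemma path_weight_singleton [simp]: "path_weight m [x] = 0"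
  by (simp add: path_weight_def)

lemma path_weight_Cons_Cons [simp]:
  "path_weight m (x # y # p) = m $$ (x, y) + path_weight m (y # p)"
  unfolding path_weight_def by (simp add: sum.lessThan_Suc_shift del: sum.lessThan_Suc)

lemma path_weight_append:
  "path_weight m (xs @ y # zs) = path_weight m (xs @ [y]) + path_weight m (y # zs)"
proof (induction xs)
  case (Cons x xs)
  then show ?case by (cases xs) (simp_all add: add.assoc)
qed simp

text \<open>\<open>tl q\<close> drops the second copy of the meeting vertex \<open>k\<close>, which
  would otherwise add a loop edge.\<close>

lemma is_walk_append:
  assumes "is_walk d i k p" "is_walk d k j q"
  shows "is_walk d i j (p @ tl q)"
    and "path_weight m (p @ tl q) = path_weight m p + path_weight m q"
proof -
  obtain xs where xs: "p = xs @ [k]"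
    using assms(1) by (metis append_butlast_last_id is_walk_def)
  obtain zs where zs: "q = k # zs"
    using assms(2) by (metis is_walk_def list.collapse)
  show "is_walk d i j (p @ tl q)"
    using assms unfolding xs zs is_walk_def by (auto simp: hd_append)
  show "path_weight m (p @ tl q) = path_weight m p + path_weight m q"
    unfolding xs zs using path_weight_append[of m xs k zs] by simp
qed

section \<open>Elementary facts on matrices, domains and joins\<close>

lemma DBM_I:
  assumes "dim_row m = d" "dim_col m = d"
    and "\<And>i j. i < d \<Longrightarrow> j < d \<Longrightarrow> m $$ (i, j) \<in> insert \<infinity> (ereal ` I)"
  shows "m \<in> DBM I d"
  unfolding DBM_def carrier_mat_def using assms by simp

lemma DBM_dim [simp]: "m \<in> DBM I d \<Longrightarrow> dim_row m = d" "m \<in> DBM I d \<Longrightarrow> dim_col m = d"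
  by (auto simp: DBM_def)

lemma DBM_entry: "m \<in> DBM I d \<Longrightarrow> i < d \<Longrightarrow> j < d \<Longrightarrow> m $$ (i, j) \<in> insert \<infinity> (ereal ` I)"
  by (auto simp: DBM_def)

lemma dbm_closure_dim [simp]:
  "dim_row (dbm_closure m) = dim_row m" "dim_col (dbm_closure m) = dim_row m"
  by (simp_all add: dbm_closure_def)

lemma dbm_max_dim [simp]: "dim_row (dbm_max m n) = dim_row m" "dim_col (dbm_max m n) = dim_col m"
  by (simp_all add: dbm_max_def)

lemma dbm_max_entry [simp]:
  "i < dim_row m \<Longrightarrow> j < dim_col m \<Longrightarrow> dbm_max m n $$ (i, j) = max (m $$ (i, j)) (n $$ (i, j))"
  by (simp add: dbm_max_def)

lemma dbm_max_in_DBM: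
  assumes "m \<in> DBM I d" "n \<in> DBM I d"
  shows "dbm_max m n \<in> DBM I d"
proof -
  have "dbm_max m n $$ (i, j) \<in> insert \<infinity> (ereal ` I)" if "i < d" "j < d" for i j
    using DBM_entry[OF assms(1) that] DBM_entry[OF assms(2) that] assms that
    by (simp only: dbm_max_entry DBM_dim max_def split: if_split) blast
  then show ?thesis using assms by (intro DBM_I) simp_all
qed

lemma dbm_domD:
  "x \<in> dbm_dom I m \<Longrightarrow> i < dim_row m \<Longrightarrow> j < dim_row m \<Longrightarrow> ereal (x $ j - x $ i) \<le> m $$ (i, j)"
  by (simp add: dbm_dom_def)

lemma dbm_dom_mono:
  assumes "m \<le> n" "dim_row m = dim_col m"
  shows "dbm_dom I m \<subseteq> dbm_dom I n"
proof -
  have "w \<le> n $$ (i, j)" if "w \<le> m $$ (i, j)" "i < dim_row m" "j < dim_row m" for w i j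
    using assms that order_trans[OF that(1)] by (simp add: less_eq_mat_def)
  then show ?thesis using assms(1) by (auto simp: dbm_dom_def less_eq_mat_def)
qed

lemma dbm_dom0_mono:
  assumes "m \<le> n" "dim_row m = dim_col m"
  shows "dbm_dom0 I m \<subseteq> dbm_dom0 I n"
  using dbm_dom_mono[OF assms] assms(1) unfolding dbm_dom0_def less_eq_mat_def by auto

lemma dbm_max_upper:
  assumes "m \<in> DBM I d" "n \<in> DBM I d"
  shows "m \<le> dbm_max m n" "n \<le> dbm_max m n"
  using assms by (auto simp: less_eq_mat_def)

lemma dbm_max_least:
  assumes "m \<in> DBM I d" "n \<in> DBM I d" "m \<le> r" "n \<le> r"
  shows "dbm_max m n \<le> r"
  using assms by (auto simp: less_eq_mat_def)

lemma dbm_dom0_max_superset: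
  assumes "m \<in> DBM I d" "n \<in> DBM I d"
  shows "dbm_dom0 I m \<union> dbm_dom0 I n \<subseteq> dbm_dom0 I (dbm_max m n)"
  using dbm_max_upper[OF assms] assms by (simp add: dbm_dom0_mono)

section \<open>Existence of shortest walks\<close>

text \<open>Telescoping: the constraints along a walk add up to one on its endpoints. In particular,
  closed walks have non-negative weight.\<close>

lemma path_weight_ge:
  assumes "x \<in> dbm_dom I m" "is_walk (dim_row m) i j p"
  shows "ereal (x $ j - x $ i) \<le> path_weight m p"
  using assms(2)
proof (induction p arbitrary: i)
  case (Cons a p)
  show ?case
  proof (cases p)
    case Nil
    then show ?thesis using Cons.prems by (auto simp: is_walk_def zero_ereal_def)
  next
    case (Cons b q)
    have ab: "a = i" "i < dim_row m" "b < dim_row m" and w: "is_walk (dim_row m) b j p"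
      using Cons.prems Cons by (auto simp: is_walk_def)
    have "ereal (x $ j - x $ i) = ereal (x $ b - x $ i) + ereal (x $ j - x $ b)" by simp
    also have "\<dots> \<le> m $$ (i, b) + path_weight m p"
      using dbm_domD[OF assms(1)] ab Cons.IH[OF w] by (intro add_mono) auto
    finally show ?thesis by (simp add: Cons ab)
  qed
qed (simp add: is_walk_def)

text \<open>Cycles have non-negative weight when the domain is non-empty, so they can be cut out.\<close>
lemma distinct_walk_le:
  assumes x: "x \<in> dbm_dom I m" and p: "is_walk (dim_row m) i j p"
  obtains q where "is_walk (dim_row m) i j q" "distinct q" "path_weight m q \<le> path_weight m p"
  using p
proof (induction "length p" arbitrary: p thesis rule: less_induct)
  case less
  show ?case
  proof (cases "distinct p")
    case True
    then show ?thesis using less.prems by blast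
  next
    case False
    then obtain xs y ys zs where p: "p = xs @ [y] @ ys @ [y] @ zs"
      using not_distinct_decomp by blast
    have walk: "is_walk (dim_row m) i j (xs @ y # zs)"
      using less.prems(2) unfolding p is_walk_def by (auto simp: hd_append split: if_splits)
    have "is_walk (dim_row m) y y (y # ys @ [y])"
      using less.prems(2) unfolding p is_walk_def by auto
    from path_weight_ge[OF x this] have cycle: "0 \<le> path_weight m (y # ys @ [y])"
      by (simp add: zero_ereal_def)
    have "path_weight m p = path_weight m (xs @ [y]) +
        (path_weight m (y # ys @ [y]) + path_weight m (y # zs))"
      unfolding p using path_weight_append[of m xs y "ys @ y # zs"]
        path_weight_append[of m "y # ys" y zs] by simp
    \<comment> \<open>Replacing the cycle by 0 under monotone addition avoids cancellation, which
      fails in \<open>ereal\<close> at infinite weights.\<close>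
    also have "\<dots> \<ge> path_weight m (xs @ [y]) + (0 + path_weight m (y # zs))"
      by (intro add_mono cycle order_refl)
    finally have le: "path_weight m (xs @ y # zs) \<le> path_weight m p"
      by (simp add: path_weight_append[of m xs y zs])
    show ?thesis
      by (rule less.hyps[OF _ _ walk]) (use less.prems(1) le p in \<open>auto intro: order_trans\<close>)
  qed
qed

text \<open>A repetition-free list of indices below \<open>d\<close> has at most \<open>d\<close>
  elements.\<close>

lemma finite_distinct_walks: "finite {p. is_walk d i j p \<and> distinct p}"
proof (rule finite_subset)
  show "{p. is_walk d i j p \<and> distinct p} \<subseteq> {p. set p \<subseteq> {..<d} \<and> length p \<le> d}"
    using distinct_card[symmetric] card_mono[of "{..<d}"] by (fastforce simp: is_walk_def)
qed (simp add: finite_lists_length_le)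

text \<open>It suffices to minimise over the finitely many repetition-free walks, since every walk
  is matched by one of no greater weight.\<close>

lemma shortest_walk:
  assumes x: "x \<in> dbm_dom I m" and ij: "i < dim_row m" "j < dim_row m"
  obtains p where "is_walk (dim_row m) i j p"
    "\<And>q. is_walk (dim_row m) i j q \<Longrightarrow> path_weight m p \<le> path_weight m q"
proof -
  let ?S = "{p. is_walk (dim_row m) i j p \<and> distinct p}"
  have "is_walk (dim_row m) i j [i, j]" using ij by (simp add: is_walk_def)
  then have "?S \<noteq> {}" using distinct_walk_le[OF x] by blast
  define p where "p = arg_min_on (path_weight m) ?S"
  have p: "p \<in> ?S" "\<And>q. q \<in> ?S \<Longrightarrow> path_weight m p \<le> path_weight m q"
    unfolding p_def
    by (fact arg_min_if_finite(1)[OF finite_distinct_walks \<open>?S \<noteq> {}\<close>],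
        fact arg_min_least[OF finite_distinct_walks \<open>?S \<noteq> {}\<close>])
  show ?thesis
  proof (rule that)
    show "is_walk (dim_row m) i j p" using p(1) by simp
    fix q assume "is_walk (dim_row m) i j q"
    then obtain q' where "q' \<in> ?S" "path_weight m q' \<le> path_weight m q"
      using distinct_walk_le[OF x] by blast
    with p(2) show "path_weight m p \<le> path_weight m q" by (blast intro: order_trans)
  qed
qed

section \<open>Shortest-path closure\<close>

text \<open>Treats all entries uniformly as attained minima. The diagonal 0 fits in as the weight of
  \<open>[i]\<close>, minimal because closed walks have non-negative weight.\<close>

lemma dbm_closure_walk:
  assumes x: "x \<in> dbm_dom I m" and ij: "i < dim_row m" "j < dim_row m"
  obtains p where "is_walk (dim_row m) i j p" "dbm_closure m $$ (i, j) = path_weight m p"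
    "\<And>q. is_walk (dim_row m) i j q \<Longrightarrow> path_weight m p \<le> path_weight m q"
proof (cases "i = j")
  case True
  have "is_walk (dim_row m) i j [i]" using True ij by (simp add: is_walk_def)
  moreover have "0 \<le> path_weight m q" if "is_walk (dim_row m) i j q" for q
    using path_weight_ge[OF x that] True by (simp add: zero_ereal_def)
  ultimately show ?thesis
    using that[of "[i]"] True ij by (simp add: dbm_closure_def)
next
  case False
  obtain p where p: "is_walk (dim_row m) i j p"
    "\<And>q. is_walk (dim_row m) i j q \<Longrightarrow> path_weight m p \<le> path_weight m q"
    using shortest_walk[OF x ij] by blast
  have "(LEAST w. \<exists>p. is_walk (dim_row m) i j p \<and> w = path_weight m p) = path_weight m p"
    using p by (intro Least_equality) auto
  then have "dbm_closure m $$ (i, j) = path_weight m p"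
    using ij False by (simp add: dbm_closure_def is_walk_def conj_assoc)
  then show ?thesis using that p by blast
qed

lemma dbm_closure_le_walk:
  assumes "x \<in> dbm_dom I m" "is_walk (dim_row m) i j p"
  shows "dbm_closure m $$ (i, j) \<le> path_weight m p"
proof -
  have "i < dim_row m" "j < dim_row m"
    using assms(2) hd_in_set[of p] last_in_set[of p] by (auto simp: is_walk_def)
  then show ?thesis using dbm_closure_walk[OF assms(1), of i j] assms(2) by metis
qed

lemma dbm_closure_diag: "i < dim_row m \<Longrightarrow> dbm_closure m $$ (i, i) = 0"
  by (simp add: dbm_closure_def)

text \<open>Shortest walks from \<open>i\<close> to \<open>k\<close> and from \<open>k\<close> to
  \<open>j\<close> concatenate to a competitor from \<open>i\<close> to \<open>j\<close>.\<close>

lemma dbm_closure_triangle: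
  assumes "x \<in> dbm_dom I m" "i < dim_row m" "j < dim_row m" "k < dim_row m"
  shows "dbm_closure m $$ (i, j) \<le> dbm_closure m $$ (i, k) + dbm_closure m $$ (k, j)"
proof -
  obtain p q where p: "is_walk (dim_row m) i k p" "dbm_closure m $$ (i, k) = path_weight m p"
    and q: "is_walk (dim_row m) k j q" "dbm_closure m $$ (k, j) = path_weight m q"
    using dbm_closure_walk[OF assms(1)] assms(2-4) by metis
  show ?thesis
    using dbm_closure_le_walk[OF assms(1) is_walk_append(1)[OF p(1) q(1)]] p q
    by (simp add: is_walk_append(2)[OF p(1) q(1)])
qed

lemma dbm_closure_le:
  assumes "x \<in> dbm_dom I m" "m \<in> DBM I d"
  shows "dbm_closure m \<le> m"
  using dbm_closure_le_walk[OF assms(1), of _ _ "[_, _]"] assms(2)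
  by (auto simp: less_eq_mat_def is_walk_def)

text \<open>Constraints in the closure are sums of given ones along walks, so they exclude no point;
  the other inclusion is monotonicity.\<close>

lemma dbm_dom_closure:
  assumes "x \<in> dbm_dom I m" "m \<in> DBM I d"
  shows "dbm_dom I (dbm_closure m) = dbm_dom I m"
proof
  show "dbm_dom I (dbm_closure m) \<subseteq> dbm_dom I m"
    by (rule dbm_dom_mono[OF dbm_closure_le[OF assms]]) simp
  have "ereal (y $ j - y $ i) \<le> dbm_closure m $$ (i, j)"
    if "y \<in> dbm_dom I m" "i < dim_row m" "j < dim_row m" for y i j
    using dbm_closure_walk[OF that] path_weight_ge[OF that(1)] by metis
  then show "dbm_dom I m \<subseteq> dbm_dom I (dbm_closure m)"
    unfolding dbm_dom_def[of I "dbm_closure m"] by (auto simp: dbm_dom_def)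
qed

lemma dbm_dom0_closure:
  assumes "x \<in> dbm_dom I m" "m \<in> DBM I d"
  shows "dbm_dom0 I (dbm_closure m) = dbm_dom0 I m"
  using dbm_dom_closure[OF assms] by (simp add: dbm_dom0_def)

lemma dom_of_dom0: "dbm_dom0 I m \<noteq> {} \<Longrightarrow> \<exists>x. x \<in> dbm_dom I m"
  by (auto simp: dbm_dom0_def)

section \<open>Closedness of joins\<close>

text \<open>Iterating the triangle inequality along a walk shows that no detour beats the direct
  edge.\<close>

lemma le_path_weight_if_triangle:
  assumes diag: "\<And>i. i < d \<Longrightarrow> c $$ (i, i) = 0"
    and tri: "\<And>i j k. i < d \<Longrightarrow> j < d \<Longrightarrow> k < d \<Longrightarrow> c $$ (i, j) \<le> c $$ (i, k) + c $$ (k, j)"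
    and "is_walk d i j p"
  shows "c $$ (i, j) \<le> path_weight c p"
  using assms(3)
proof (induction p arbitrary: i)
  case (Cons a p)
  show ?case
  proof (cases p)
    case Nil
    then show ?thesis using Cons.prems diag by (auto simp: is_walk_def)
  next
    case (Cons b q)
    have ab: "a = i" "i < d" "b < d" "j < d" and w: "is_walk d b j p"
      using Cons.prems Cons last_in_set[of p] by (auto simp: is_walk_def)
    have "c $$ (i, j) \<le> c $$ (i, b) + c $$ (b, j)" using tri ab by blast
    also have "\<dots> \<le> c $$ (i, b) + path_weight c p" by (intro add_mono Cons.IH[OF w] order_refl)
    finally show ?thesis by (simp add: Cons ab)
  qed
qed (simp add: is_walk_def)

lemma dbm_closed_max:
  assumes mn: "m \<in> DBM I d" "n \<in> DBM I d" and closed: "dbm_closed I m" "dbm_closed I n"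
  shows "dbm_closed I (dbm_max m n)"
proof -
  let ?c = "dbm_max m n"
  obtain x y where x: "x \<in> dbm_dom I m" and y: "y \<in> dbm_dom I n"
    and eq: "dbm_closure m = m" "dbm_closure n = n"
    using closed dom_of_dom0 unfolding dbm_closed_def by metis
  have ne: "dbm_dom0 I ?c \<noteq> {}"
    using closed(1) dbm_dom0_max_superset[OF mn] by (auto simp: dbm_closed_def)
  then obtain z where z: "z \<in> dbm_dom I ?c" using dom_of_dom0 by blast
  have diag: "?c $$ (i, i) = 0" if "i < d" for i
    using that dbm_closure_diag[of i m] dbm_closure_diag[of i n] mn by (simp add: eq)
  have tri: "?c $$ (i, j) \<le> ?c $$ (i, k) + ?c $$ (k, j)" if "i < d" "j < d" "k < d" for i j k
  proof -
    have "m $$ (i, j) \<le> m $$ (i, k) + m $$ (k, j)" "n $$ (i, j) \<le> n $$ (i, k) + n $$ (k, j)"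
      using dbm_closure_triangle[OF x] dbm_closure_triangle[OF y] that mn by (simp_all add: eq)
    moreover have "m $$ (i, k) + m $$ (k, j) \<le> ?c $$ (i, k) + ?c $$ (k, j)"
        "n $$ (i, k) + n $$ (k, j) \<le> ?c $$ (i, k) + ?c $$ (k, j)"
      using that mn by (auto intro!: add_mono)
    ultimately show ?thesis using that mn by (auto intro: order_trans)
  qed
  \<comment> \<open>The closure entry is the weight of some walk, and no walk weighs less than the
    entry of \<open>?c\<close>.\<close>
  have "?c $$ (i, j) \<le> dbm_closure ?c $$ (i, j)" if "i < d" "j < d" for i j
    using dbm_closure_walk[OF z, of i j] le_path_weight_if_triangle[of d ?c, OF diag tri] that mn
    by (metis DBM_dim(1) dbm_max_dim(1))
  then have "?c \<le> dbm_closure ?c" using mn by (simp add: less_eq_mat_def)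
  with dbm_closure_le[OF z dbm_max_in_DBM[OF mn]] ne show ?thesis
    by (auto simp: dbm_closed_def)
qed

section \<open>Scalars and normalisation of coordinate 0\<close>

text \<open>Treats the three scalar domains at once, as additive subgroups of the reals containing
  1; the element 1 supplies arbitrarily large natural shifts inside \<open>I\<close>.\<close>

locale dbm_scalars =
  fixes I :: "real set"
  assumes one_mem: "1 \<in> I" and diff_mem: "\<And>a b. a \<in> I \<Longrightarrow> b \<in> I \<Longrightarrow> a - b \<in> I"
begin

lemma zero_mem: "0 \<in> I"
  using diff_mem[OF one_mem one_mem] by simp

lemma add_mem: "a \<in> I \<Longrightarrow> b \<in> I \<Longrightarrow> a + b \<in> I"
  using diff_mem[of a "0 - b"] diff_mem[OF zero_mem, of b] by simp

lemma of_nat_mem: "of_nat k \<in> I"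
  by (induction k) (auto intro: zero_mem one_mem add_mem)

lemma path_weight_mem:
  assumes "m \<in> DBM I d" "is_walk d i j p"
  shows "path_weight m p \<in> insert \<infinity> (ereal ` I)"
  using assms(2)
proof (induction p arbitrary: i)
  case (Cons a p)
  show ?case
  proof (cases p)
    case Nil
    then show ?thesis using zero_mem by (auto simp: zero_ereal_def)
  next
    case (Cons b q)
    have "a < d" "b < d" and w: "is_walk d b j p"
      using Cons.prems Cons by (auto simp: is_walk_def)
    then have "m $$ (a, b) \<in> insert \<infinity> (ereal ` I)" using DBM_entry[OF assms(1)] by blast
    with Cons.IH[OF w] show ?thesis by (auto simp: Cons intro: add_mem)
  qed
qed (simp add: is_walk_def)

text \<open>Because the minimum is attained, each entry is a finite sum of entries of
  \<open>m\<close>.\<close>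

lemma dbm_closure_in_DBM:
  assumes "x \<in> dbm_dom I m" "m \<in> DBM I d"
  shows "dbm_closure m \<in> DBM I d"
proof -
  have "dbm_closure m $$ (i, j) \<in> insert \<infinity> (ereal ` I)" if "i < d" "j < d" for i j
    using dbm_closure_walk[OF assms(1), of i j] path_weight_mem[OF assms(2)] that assms(2)
    by (metis DBM_dim(1))
  then show ?thesis using assms(2) by (intro DBM_I) simp_all
qed

text \<open>Only differences matter for the domain, so any point may be translated to one whose
  coordinate 0 vanishes.\<close>
lemma dbm_dom_iff_dom0:
  assumes "dim_row m = Suc e"
  shows "x \<in> dbm_dom I m \<longleftrightarrow> x \<in> carrier_vec (Suc e) \<and> (\<forall>i<Suc e. x $ i \<in> I) \<and>
    vec e (\<lambda>i. x $ Suc i - x $ 0) \<in> dbm_dom0 I m"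
proof -
  define v where "v = vCons 0 (vec e (\<lambda>i. x $ Suc i - x $ 0))"
  have v: "v \<in> carrier_vec (Suc e)" by (simp add: v_def)
  have shift: "v $ i = x $ i - x $ 0" if "i < Suc e" for i
    using that by (cases i) (auto simp: v_def)
  have dom0: "vec e (\<lambda>i. x $ Suc i - x $ 0) \<in> dbm_dom0 I m \<longleftrightarrow> v \<in> dbm_dom I m"
    by (simp add: dbm_dom0_def v_def assms)
  have mem: "v $ i \<in> I" if "i < Suc e" "\<forall>i<Suc e. x $ i \<in> I" for i
    using that shift diff_mem by simp
  have diff: "v $ j - v $ i = x $ j - x $ i" if "i < Suc e" "j < Suc e" for i j
    using that shift by simp
  show ?thesis
    unfolding dom0 dbm_dom_def assms mem_Collect_eq using v mem
    by (simp add: diff cong: imp_cong conj_cong)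
qed

section \<open>From inclusion of domains to the entrywise order\<close>

text \<open>The extremal point built next vanishes at an arbitrary index \<open>a\<close> rather
  than at 0, which calls for inclusion of the full domains.\<close>

lemma dbm_dom_subset:
  assumes "dbm_dom0 I m \<subseteq> dbm_dom0 I r" "dim_row m = d" "dim_row r = d" "d \<ge> 1"
  shows "dbm_dom I m \<subseteq> dbm_dom I r"
proof -
  obtain e where "d = Suc e" using assms(4) by (cases d) auto
  then show ?thesis using assms dbm_dom_iff_dom0[of m e] dbm_dom_iff_dom0[of r e] by blast
qed

text \<open>Taking \<open>w\<close> in \<open>ereal\<close> covers finite and infinite entries at
  once: a bound strictly below the closure entry is refuted by a single point.\<close>

lemma dbm_closure_tight:
  assumes y: "y \<in> dbm_dom I m" and m: "m \<in> DBM I d" and ab: "a < d" "b < d"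
    and bound: "\<And>x. x \<in> dbm_dom I m \<Longrightarrow> ereal (x $ b - x $ a) \<le> w"
  shows "dbm_closure m $$ (a, b) \<le> w"
proof (rule ccontr)
  let ?c = "dbm_closure m"
  assume "\<not> ?c $$ (a, b) \<le> w"
  then have w: "w < ?c $$ (a, b)" by simp
  \<comment> \<open>Being strictly below another value, \<open>w\<close> is not
    \<open>\<infinity>\<close>; passing to \<open>r\<close> also covers minus infinity.\<close>
  then obtain r where r: "w \<le> ereal r" by (cases w) auto
  \<comment> \<open>The first summand makes \<open>y $ a + k\<close> positive, so that
    \<open>x $ a\<close> becomes 0; the second gives \<open>r < y $ b + k\<close>. A natural
    \<open>k\<close> keeps the shifted coordinates in \<open>I\<close>.\<close>
  obtain k :: nat where k: "\<bar>y $ a\<bar> + \<bar>r - y $ b\<bar> < k" using reals_Archimedean2 by blast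
  have y': "y \<in> dbm_dom I ?c" using dbm_dom_closure[OF y m] y by simp
  have c: "?c \<in> DBM I d" by (rule dbm_closure_in_DBM[OF y m])
  \<comment> \<open>The cap \<open>y $ j + k\<close> keeps the minimum finite even at infinite
    closure entries, so \<open>real_of_ereal\<close> loses nothing.\<close>
  define x where "x = vec d (\<lambda>j. real_of_ereal (min (?c $$ (a, j)) (ereal (y $ j + k))))"
  have x_eq: "ereal (x $ j) = min (?c $$ (a, j)) (ereal (y $ j + k))" and x_mem: "x $ j \<in> I"
    if "j < d" for j
  proof -
    have "y $ j + k \<in> I" using y m that by (auto simp: dbm_dom_def intro: add_mem of_nat_mem)
    with DBM_entry[OF c ab(1) that] have "min (?c $$ (a, j)) (ereal (y $ j + k)) \<in> ereal ` I"
      by (auto simp: min_def)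
    then obtain t where "t \<in> I" "min (?c $$ (a, j)) (ereal (y $ j + k)) = ereal t" by blast
    then show "ereal (x $ j) = min (?c $$ (a, j)) (ereal (y $ j + k))" "x $ j \<in> I"
      using that by (simp_all add: x_def)
  qed
  have "ereal (x $ j - x $ i) \<le> ?c $$ (i, j)" if ij: "i < d" "j < d" for i j
  proof (cases "?c $$ (i, j)")
    case (real t)
    have tri: "?c $$ (a, j) \<le> ?c $$ (a, i) + ereal t"
      using dbm_closure_triangle[OF y, of a j i] m ab ij real by simp
    have "y $ j - y $ i \<le> t" using dbm_domD[OF y', of i j] m ij real by simp
    then have "ereal (y $ j + k) \<le> ereal (y $ i + k) + ereal t" by simp
    \<comment> \<open>Both arguments of the minimum grow by at most \<open>t\<close> from
      \<open>i\<close> to \<open>j\<close>, hence so does the minimum.\<close>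
    with tri have "ereal (x $ j) \<le> ereal (x $ i) + ereal t"
      unfolding x_eq[OF ij(1)] x_eq[OF ij(2)] by (auto simp: min_def intro: order_trans)
    then show ?thesis using real by simp
  qed (use DBM_entry[OF c ij] in auto)
  moreover have "x \<in> carrier_vec d" by (simp add: x_def)
  ultimately have "x \<in> dbm_dom I ?c"
    using x_mem m unfolding dbm_dom_def by simp
  then have x: "ereal (x $ b - x $ a) \<le> w" using bound dbm_dom_closure[OF y m] by simp
  have "x $ a = 0"
    using x_eq[OF ab(1)] dbm_closure_diag[of a m] ab m k by (auto simp: min_def split: if_splits)
  moreover have "w < ereal (x $ b)"
    unfolding x_eq[OF ab(2)] using w r k by (auto intro: le_less_trans)
  ultimately show False using x by simp
qed

text \<open>Each entry of \<open>r\<close> bounds the corresponding difference on the domain of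
  \<open>m\<close>, and closure entries are the least such bounds.\<close>

lemma dbm_closure_le_of_dom0_subset:
  assumes m: "m \<in> DBM I d" and r: "r \<in> DBM I d" and "d \<ge> 1"
    and ne: "dbm_dom0 I m \<noteq> {}" and sub: "dbm_dom0 I m \<subseteq> dbm_dom0 I r"
  shows "dbm_closure m \<le> r"
proof -
  obtain y where y: "y \<in> dbm_dom I m" using dom_of_dom0[OF ne] by blast
  have sub': "dbm_dom I m \<subseteq> dbm_dom I r" using dbm_dom_subset[OF sub] m r \<open>d \<ge> 1\<close> by simp
  have "dbm_closure m $$ (i, j) \<le> r $$ (i, j)" if "i < d" "j < d" for i j
    using dbm_closure_tight[OF y m that] dbm_domD[OF subsetD[OF sub'], of _ i j] r that by simp
  then show ?thesis using m r by (simp add: less_eq_mat_def)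
qed

text \<open>The join belongs to the set it bounds, so the infimum is a minimum. Minimality is
  checked for each closure separately.\<close>

lemma dbm_max_closure_best:
  assumes mn: "m \<in> DBM I d" "n \<in> DBM I d" and "d \<ge> 1"
    and ne: "dbm_dom0 I m \<noteq> {}" "dbm_dom0 I n \<noteq> {}"
  defines "g \<equiv> dbm_max (dbm_closure m) (dbm_closure n)"
  shows "is_least_in {p \<in> DBM I d. dbm_dom0 I m \<union> dbm_dom0 I n \<subseteq> dbm_dom0 I p} g"
proof -
  obtain x y where x: "x \<in> dbm_dom I m" and y: "y \<in> dbm_dom I n"
    using ne dom_of_dom0 by metis
  have c: "dbm_closure m \<in> DBM I d" "dbm_closure n \<in> DBM I d"
    using dbm_closure_in_DBM x y mn by blast+
  have "dbm_dom0 I m \<union> dbm_dom0 I n \<subseteq> dbm_dom0 I g"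
    using dbm_dom0_max_superset[OF c] dbm_dom0_closure[OF x mn(1)] dbm_dom0_closure[OF y mn(2)]
    by (simp add: g_def)
  moreover have "g \<in> DBM I d" unfolding g_def by (rule dbm_max_in_DBM[OF c])
  moreover have "g \<le> r"
    if "r \<in> DBM I d" "dbm_dom0 I m \<union> dbm_dom0 I n \<subseteq> dbm_dom0 I r" for r
    unfolding g_def using that mn ne \<open>d \<ge> 1\<close>
    by (intro dbm_max_least[OF c] dbm_closure_le_of_dom0_subset) auto
  ultimately show ?thesis by (auto simp: is_least_in_def)
qed

end

lemma is_glb_in_if_least:
  assumes "is_least_in S g" "S \<subseteq> P"
  shows "is_glb_in P S g"
  using assms by (auto simp: is_glb_in_def is_least_in_def)

theorem theorem6:
  fixes I :: "real set" and d :: nat and m n :: "ereal mat"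
  assumes "I \<in> {\<int>, \<rat>, UNIV}"
    and "d \<ge> 1"
    and "m \<in> DBM I d" and "n \<in> DBM I d"
  shows "dbm_dom0 I (dbm_max m n) \<supseteq> dbm_dom0 I m \<union> dbm_dom0 I n \<and>
    (dbm_dom0 I m \<noteq> {} \<and> dbm_dom0 I n \<noteq> {} \<longrightarrow>
      is_glb_in (DBM I d) {p \<in> DBM I d. dbm_dom0 I p \<supseteq> dbm_dom0 I m \<union> dbm_dom0 I n}
        (dbm_max (dbm_closure m) (dbm_closure n)) \<and>
      is_least_in {X. is_V0_domain I d X \<and> X \<supseteq> dbm_dom0 I m \<union> dbm_dom0 I n}
        (dbm_dom0 I (dbm_max (dbm_closure m) (dbm_closure n)))) \<and>
    (dbm_closed I m \<and> dbm_closed I n \<longrightarrow> dbm_closed I (dbm_max m n))"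
proof -
  have "dbm_scalars I" unfolding dbm_scalars_def using assms(1) by auto
  then interpret dbm_scalars I .
  let ?g = "dbm_max (dbm_closure m) (dbm_closure n)"
  have "is_least_in {X. is_V0_domain I d X \<and> X \<supseteq> dbm_dom0 I m \<union> dbm_dom0 I n} (dbm_dom0 I ?g)"
    if "dbm_dom0 I m \<noteq> {}" "dbm_dom0 I n \<noteq> {}"
  proof -
    have g: "?g \<in> DBM I d" "dbm_dom0 I m \<union> dbm_dom0 I n \<subseteq> dbm_dom0 I ?g"
      and le: "\<And>r. r \<in> DBM I d \<Longrightarrow> dbm_dom0 I m \<union> dbm_dom0 I n \<subseteq> dbm_dom0 I r \<Longrightarrow> ?g \<le> r"
      using dbm_max_closure_best[OF assms(3,4,2) that] unfolding is_least_in_def by blast+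
    \<comment> \<open>Any competing domain comes from a DBM \<open>r\<close> above
      \<open>?g\<close>, and passing to domains is monotone.\<close>
    have "dbm_dom0 I ?g \<subseteq> dbm_dom0 I r"
      if "r \<in> DBM I d" "dbm_dom0 I m \<union> dbm_dom0 I n \<subseteq> dbm_dom0 I r" for r
      using dbm_dom0_mono[OF le[OF that]] DBM_dim[OF g(1)] by metis
    with g show ?thesis unfolding is_least_in_def is_V0_domain_def by blast
  qed
  moreover have "is_glb_in (DBM I d) {p \<in> DBM I d. dbm_dom0 I p \<supseteq> dbm_dom0 I m \<union> dbm_dom0 I n} ?g"
    if "dbm_dom0 I m \<noteq> {}" "dbm_dom0 I n \<noteq> {}"
    by (rule is_glb_in_if_least[OF dbm_max_closure_best[OF assms(3,4,2) that]]) auto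
  ultimately show ?thesis
    using dbm_dom0_max_superset[OF assms(3,4)] dbm_closed_max[OF assms(3,4)] by blast
qed

end
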